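(* Let $\mathcal{A}$ be a labeling automaton over $\Sigma$. The ideals of $(\Sigma^*,\preceq_{\mathcal{A}})$ are precisely the sets of the form $\downarrow_{\preceq_\mathcal{A}}(u_0v_1^*u_1\cdots v_n^*u_n)$, where $u_0v_1u_1\cdots v_nu_n$ is a loop pattern for $\mathcal{A}$.
   Context: A finite automaton $\mathcal{A}=(Q,\Sigma,E,I,F)$ with $E\subseteq Q\times\Sigma\times Q$ is a labeling automaton if every word $w\in\Sigma^*$ has exactly one run of $\mathcal{A}$ (starting in an initial and ending in a final state). Define $u\preceq_\mathcal{A} v$ iff $v$ can be written as $v=u_0v_1u_1\cdots v_nu_n$ with $u=u_0u_1\cdots u_n$ such that the run of $\mathcal{A}$ on $v$ is in the same state before and after reading each $v_i$. A loop pattern for $\mathcal{A}$ is a word $w=u_0v_1u_1\cdots v_nu_n$ together with this decomposition ($u_i,v_i\in\Sigma^*$) such that the run of $\mathcal{A}$ on $w$ is in the same state before and after each $v_i$. An ideal of a WQO is a nonempty, downward closed, directed subset; $\downarrow_\preceq S=\{x\mid \exists s\in S: x\preceq s\}$. *)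

theory Defs
  imports Main
begin

definition finite_automaton ::
  "'q set \<Rightarrow> 'a set \<Rightarrow> ('q \<times> 'a \<times> 'q) set \<Rightarrow> 'q set \<Rightarrow> 'q set \<Rightarrow> bool" where
  "finite_automaton Q \<Sigma> E I F \<longleftrightarrow> finite Q \<and> finite \<Sigma> \<and>
     E \<subseteq> Q \<times> \<Sigma> \<times> Q \<and> I \<subseteq> Q \<and> F \<subseteq> Q"

definition is_run ::
  "('q \<times> 'a \<times> 'q) set \<Rightarrow> 'q set \<Rightarrow> 'q set \<Rightarrow> 'a list \<Rightarrow> 'q list \<Rightarrow> bool" where
  "is_run E I F w qs \<longleftrightarrow> length qs = length w + 1 \<and> qs ! 0 \<in> I \<and> last qs \<in> F \<and>
     (\<forall>i < length w. (qs ! i, w ! i, qs ! Suc i) \<in> E)"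

definition labeling_automaton ::
  "'q set \<Rightarrow> 'a set \<Rightarrow> ('q \<times> 'a \<times> 'q) set \<Rightarrow> 'q set \<Rightarrow> 'q set \<Rightarrow> bool" where
  "labeling_automaton Q \<Sigma> E I F \<longleftrightarrow> finite_automaton Q \<Sigma> E I F \<and>
     (\<forall>w \<in> lists \<Sigma>. \<exists>!qs. is_run E I F w qs)"

definition the_run ::
  "('q \<times> 'a \<times> 'q) set \<Rightarrow> 'q set \<Rightarrow> 'q set \<Rightarrow> 'a list \<Rightarrow> 'q list" where
  "the_run E I F w = (THE qs. is_run E I F w qs)"

text \<open>A pattern u0 v1 u1 ... vn un is represented as (u0, [(v1,u1),...,(vn,un)]).\<close>
type_synonym 'a pattern = "'a list \<times> ('a list \<times> 'a list) list"

definition pat_word :: "'a pattern \<Rightarrow> 'a list" where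
  "pat_word p = fst p @ concat (map (\<lambda>(v, u). v @ u) (snd p))"

definition pat_base :: "'a pattern \<Rightarrow> 'a list" where
  "pat_base p = fst p @ concat (map snd (snd p))"

text \<open>position in pat_word p right before v_(i+1) (0-indexed i)\<close>
definition pat_start :: "'a pattern \<Rightarrow> nat \<Rightarrow> nat" where
  "pat_start p i = length (fst p @ concat (map (\<lambda>(v, u). v @ u) (take i (snd p))))"

definition loop_pattern ::
  "'a set \<Rightarrow> ('q \<times> 'a \<times> 'q) set \<Rightarrow> 'q set \<Rightarrow> 'q set \<Rightarrow> 'a pattern \<Rightarrow> bool" where
  "loop_pattern \<Sigma> E I F p \<longleftrightarrow> pat_word p \<in> lists \<Sigma> \<and>
     (\<forall>i < length (snd p).
        the_run E I F (pat_word p) ! pat_start p i =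
        the_run E I F (pat_word p) ! (pat_start p i + length (fst (snd p ! i))))"

definition leqA ::
  "'a set \<Rightarrow> ('q \<times> 'a \<times> 'q) set \<Rightarrow> 'q set \<Rightarrow> 'q set \<Rightarrow> 'a list \<Rightarrow> 'a list \<Rightarrow> bool" where
  "leqA \<Sigma> E I F u v \<longleftrightarrow> u \<in> lists \<Sigma> \<and> v \<in> lists \<Sigma> \<and>
     (\<exists>p. loop_pattern \<Sigma> E I F p \<and> pat_word p = v \<and> pat_base p = u)"

definition down_closure ::
  "'a set \<Rightarrow> ('q \<times> 'a \<times> 'q) set \<Rightarrow> 'q set \<Rightarrow> 'q set \<Rightarrow> 'a list set \<Rightarrow> 'a list set" where
  "down_closure \<Sigma> E I F S = {x. \<exists>s \<in> S. leqA \<Sigma> E I F x s}"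

definition is_ideal ::
  "'a set \<Rightarrow> ('q \<times> 'a \<times> 'q) set \<Rightarrow> 'q set \<Rightarrow> 'q set \<Rightarrow> 'a list set \<Rightarrow> bool" where
  "is_ideal \<Sigma> E I F D \<longleftrightarrow> D \<subseteq> lists \<Sigma> \<and> D \<noteq> {} \<and>
     (\<forall>x y. x \<in> lists \<Sigma> \<longrightarrow> y \<in> D \<longrightarrow> leqA \<Sigma> E I F x y \<longrightarrow> x \<in> D) \<and>
     (\<forall>x \<in> D. \<forall>y \<in> D. \<exists>z \<in> D. leqA \<Sigma> E I F x z \<and> leqA \<Sigma> E I F y z)"

definition pat_lang :: "'a pattern \<Rightarrow> 'a list set" where
  "pat_lang p = {fst p @ concat (map (\<lambda>((v, u), k). concat (replicate k v) @ u) (zip (snd p) ks))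
                 | ks. length ks = length (snd p)}"

end

theory Submission
  imports Defs "HOL-Library.Sublist" "HOL-Library.Multiset"
begin

text \<open>On the level of transition sequences of runs, \<open>\<preceq>\<close> is the subsequence order between paths
  with the same end points. Given an ideal \<open>D\<close> of paths, take a product \<open>P\<close> of atoms \<open>{\<epsilon>, t}\<close> and
  \<open>A\<^sup>*\<close> that contains \<open>D\<close> and is minimal in the multiset order of the sizes of the \<open>A\<close>'s. Replacing
  \<open>{\<epsilon>, t}\<close> by \<open>{\<epsilon>}\<close>, or \<open>A\<^sup>*\<close> by the words over \<open>A\<close> without a given subsequence \<open>w\<close>, yields a
  smaller product, which therefore misses a member of \<open>D\<close>. A common upper bound in \<open>D\<close> of these
  members decomposes along \<open>P\<close> into factors \<open>t\<close> and factors containing \<open>w\<close>. For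
  \<open>w = (a\<^sub>1\<dots>a\<^sub>m)\<^sup>K\<close> with \<open>A = {a\<^sub>1,\<dots>,a\<^sub>m}\<close> and large \<open>K\<close>, the pigeonhole principle gives in
  each of the latter a loop using all of \<open>A\<close>. Pumping these loops stays within \<open>P\<close> and dominates all
  of \<open>P\<close>; letting \<open>K\<close> grow shows that the pumped paths belong to \<open>D\<close>.\<close>

section \<open>Paths\<close>

type_synonym ('q, 'a) trans = "'q \<times> 'a \<times> 'q"

abbreviation tgt :: "('q, 'a) trans \<Rightarrow> 'q" where
  "tgt t \<equiv> snd (snd t)"

abbreviation label :: "('q, 'a) trans list \<Rightarrow> 'a list" where
  "label ts \<equiv> map (\<lambda>t. fst (snd t)) ts"

fun path :: "('q, 'a) trans set \<Rightarrow> 'q \<Rightarrow> ('q, 'a) trans list \<Rightarrow> 'q \<Rightarrow> bool" where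
  "path E s [] e \<longleftrightarrow> s = e"
| "path E s (t # ts) e \<longleftrightarrow> t \<in> E \<and> fst t = s \<and> path E (tgt t) ts e"

lemma path_append: "path E s (xs @ ys) e \<longleftrightarrow> (\<exists>m. path E s xs m \<and> path E m ys e)"
  by (induction xs arbitrary: s) auto

lemma path_end: "path E s ts e \<Longrightarrow> e = last (s # map tgt ts)"
  by (induction ts arbitrary: s) auto

lemma path_functional: "path E s ts e \<Longrightarrow> path E s ts e' \<Longrightarrow> e = e'"
  using path_end by metis

lemma path_subset: "path E s ts e \<Longrightarrow> set ts \<subseteq> E"
  by (induction ts arbitrary: s) auto

lemma path_end_in: "path E s ts e \<Longrightarrow> E \<subseteq> Q \<times> \<Sigma> \<times> Q \<Longrightarrow> s \<in> Q \<Longrightarrow> e \<in> Q"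
  by (induction ts arbitrary: s) auto

lemma path_nth_length:
  assumes "path E s xs m"
  shows "(s # map tgt (xs @ ys)) ! length xs = m"
  using assms by (induction xs arbitrary: s) auto

lemma path_determined:
  "path E s ts e \<Longrightarrow> path E s ts' e' \<Longrightarrow> label ts = label ts' \<Longrightarrow> map tgt ts = map tgt ts' \<Longrightarrow> ts = ts'"
proof (induction ts arbitrary: s ts')
  case (Cons t ts)
  then show ?case by (cases ts') (auto simp: prod_eq_iff)
qed simp

lemma run_path:
  assumes "length qs = length w + 1" "\<forall>i < length w. (qs ! i, w ! i, qs ! Suc i) \<in> E"
  shows "\<exists>ts. path E (hd qs) ts (last qs) \<and> label ts = w \<and> qs = hd qs # map tgt ts"
  using assms
proof (induction w arbitrary: qs)
  case Nil
  then show ?case by (auto simp: length_Suc_conv)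
next
  case (Cons a w)
  then obtain q q' qs' where qs: "qs = q # q' # qs'"
    by (auto simp: length_Suc_conv)
  have "\<forall>i < length w. ((q' # qs') ! i, w ! i, (q' # qs') ! Suc i) \<in> E"
    using Cons.prems(2) qs by fastforce
  then obtain ts where ts: "path E q' ts (last (q' # qs'))" "label ts = w" "qs' = map tgt ts"
    using Cons.IH[of "q' # qs'"] Cons.prems(1) qs by auto
  have "(q, a, q') \<in> E" using Cons.prems(2) qs by force
  then show ?case using ts qs by (intro exI[of _ "(q, a, q') # ts"]) auto
qed

lemma path_steps:
  "path E s ts e \<Longrightarrow> i < length ts \<Longrightarrow>
    ((s # map tgt ts) ! i, label ts ! i, (s # map tgt ts) ! Suc i) \<in> E"
proof (induction ts arbitrary: s i)
  case (Cons t ts)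
  then show ?case by (cases i) auto
qed simp

text \<open>Passage from state sequences to transition sequences: a run is its start state followed
  by the targets. Transitions carry their states along, so the plain subsequence order on paths can
  see loops.\<close>

lemma is_run_iff_path:
  "is_run E I F w qs \<longleftrightarrow>
    (\<exists>s ts e. s \<in> I \<and> e \<in> F \<and> path E s ts e \<and> label ts = w \<and> qs = s # map tgt ts)"
proof
  assume r: "is_run E I F w qs"
  then have "qs \<noteq> []" by (auto simp: is_run_def)
  then show "\<exists>s ts e. s \<in> I \<and> e \<in> F \<and> path E s ts e \<and> label ts = w \<and> qs = s # map tgt ts"
    using r run_path[of qs w E] by (metis is_run_def hd_conv_nth)
next
  assume "\<exists>s ts e. s \<in> I \<and> e \<in> F \<and> path E s ts e \<and> label ts = w \<and> qs = s # map tgt ts"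
  then obtain s ts e where *: "s \<in> I" "e \<in> F" "path E s ts e" "label ts = w" "qs = s # map tgt ts"
    by blast
  then show "is_run E I F w qs"
    using path_steps[OF *(3)] path_end[OF *(3)] by (auto simp: is_run_def)
qed

section \<open>Patterns of transitions\<close>

text \<open>A pattern lifted to transitions, without the leading segment \<open>u0\<close>. A
  leading segment can be expressed by a first pair whose loop is empty.\<close>

fun loops :: "('q, 'a) trans set \<Rightarrow> 'q \<Rightarrow> (('q, 'a) trans list \<times> ('q, 'a) trans list) list \<Rightarrow> 'q \<Rightarrow> bool"
where
  "loops E s [] e \<longleftrightarrow> s = e"
| "loops E s ((V, U) # r) e \<longleftrightarrow> path E s V s \<and> (\<exists>m. path E s U m \<and> loops E m r e)"

definition word :: "('b list \<times> 'b list) list \<Rightarrow> 'b list" where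
  "word r = concat (map (\<lambda>(v, u). v @ u) r)"

definition base :: "('b list \<times> 'b list) list \<Rightarrow> 'b list" where
  "base r = concat (map snd r)"

definition pump :: "('b list \<times> 'b list) list \<Rightarrow> nat list \<Rightarrow> 'b list" where
  "pump r ks = concat (map (\<lambda>((v, u), k). concat (replicate k v) @ u) (zip r ks))"

lemma word_simps [simp]: "word [] = []" "word ((v, u) # r) = v @ u @ word r"
  by (auto simp: word_def)

lemma base_simps [simp]: "base [] = []" "base ((v, u) # r) = u @ base r"
  by (auto simp: base_def)

lemma pump_simps [simp]:
  "pump [] ks = []"
  "pump ((v, u) # r) (k # ks) = concat (replicate k v) @ u @ pump r ks"
  by (auto simp: pump_def)

abbreviation label_pat where
  "label_pat r \<equiv> map (map_prod label label) r"

lemma label_concat_replicate: "label (concat (replicate k v)) = concat (replicate k (label v))"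
  by (induction k) auto

lemma word_label_pat: "word (label_pat r) = label (word r)"
  by (induction r) auto

lemma base_label_pat: "base (label_pat r) = label (base r)"
  by (induction r) auto

lemma pump_label_pat: "length ks = length r \<Longrightarrow> pump (label_pat r) ks = label (pump r ks)"
  by (induction ks r rule: list_induct2) (auto simp: label_concat_replicate)

lemma loops_word: "loops E s r e \<Longrightarrow> path E s (word r) e"
  by (induction r arbitrary: s) (auto simp: path_append, blast)

lemma loops_base: "loops E s r e \<Longrightarrow> path E s (base r) e"
  by (induction r arbitrary: s) (auto simp: path_append, blast)

lemma path_replicate: "path E s v s \<Longrightarrow> path E s (concat (replicate k v)) s"
  by (induction k) (auto simp: path_append)

lemma loops_pump: "loops E s r e \<Longrightarrow> length ks = length r \<Longrightarrow> path E s (pump r ks) e"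
proof (induction r arbitrary: s ks)
  case (Cons a r)
  then obtain v u k ks' where *: "a = (v, u)" "ks = k # ks'" "length ks' = length r"
    by (cases a) (auto simp: length_Suc_conv)
  then obtain m where m: "path E s v s" "path E s u m" "loops E m r e"
    using Cons.prems by auto
  then have "path E m (pump r ks') e" using Cons.IH * by blast
  then show ?case using m * path_replicate[of E s v k] by (auto simp: path_append)
qed simp

lemma subseq_base_word: "subseq (base r) (word r)"
proof (induction r)
  case (Cons a r)
  obtain v u where "a = (v, u)" by (cases a)
  have "subseq u (v @ u)" by (simp add: list_emb_append2)
  then have "subseq (u @ base r) ((v @ u) @ word r)"
    using Cons.IH by (intro list_emb_append_mono)
  then show ?case by (simp add: \<open>a = (v, u)\<close>)
qed simp

lemma subseq_replicate_mono:
  "k \<le> l \<Longrightarrow> subseq (concat (replicate k v)) (concat (replicate l v))"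
  by (metis le_iff_add concat_append replicate_add prefix_imp_subseq prefixI)

lemma subseq_pump_mono:
  "list_all2 (\<le>) ks ls \<Longrightarrow> length r = length ks \<Longrightarrow> subseq (pump r ks) (pump r ls)"
proof (induction ks ls arbitrary: r rule: list_all2_induct)
  case (Cons k ks l ls)
  then obtain v u r' where r: "r = (v, u) # r'" "length r' = length ks"
    by (auto simp: length_Suc_conv)
  then show ?case using Cons subseq_replicate_mono[of k l v]
    by (auto intro!: list_emb_append_mono)
qed auto

text \<open>The part \<open>xs\<close> of \<open>ts\<close> skipped before the first transition
  \<open>t\<close> of \<open>ts'\<close> starts at \<open>s\<close> and ends at the source of
  \<open>t\<close>. That source is \<open>s\<close> again, because \<open>ts'\<close> is a path from
  \<open>s\<close>; so every skipped part is a loop.\<close>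

lemma subseq_imp_loops:
  "path E s ts' e \<Longrightarrow> path E s ts e \<Longrightarrow> subseq ts' ts \<Longrightarrow>
    \<exists>r. loops E s r e \<and> word r = ts \<and> base r = ts'"
proof (induction ts' arbitrary: s ts)
  case Nil
  \<comment> \<open>Once \<open>ts'\<close> is exhausted, \<open>s = e\<close>, so what remains of
    \<open>ts\<close> is a single loop.\<close>
  then show ?case by (intro exI[of _ "[(ts, [])]"]) auto
next
  case (Cons t ts')
  from list_emb_ConsD[OF Cons.prems(3)] obtain xs ys where ts: "ts = xs @ t # ys" "subseq ts' ys"
    by auto
  from Cons.prems(1,2) ts have p: "path E s xs s" "path E (tgt t) ys e" "path E (tgt t) ts' e" "t \<in> E" "fst t = s"
    by (auto simp: path_append)
  from Cons.IH[OF p(3,2) ts(2)] obtain r where "loops E (tgt t) r e" "word r = ys" "base r = ts'"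
    by blast
  then show ?case using p ts by (intro exI[of _ "(xs, [t]) # r"]) auto
qed

section \<open>Products of atoms\<close>

text \<open>Over a finite alphabet, products of these atoms denote exactly the ideals of the
  subsequence order on words.\<close>

datatype 'b atom = Opt 'b | Star "'b set"

fun atom_lang :: "'b atom \<Rightarrow> 'b list set" where
  "atom_lang (Opt t) = {[], [t]}"
| "atom_lang (Star A) = lists A"

fun lang :: "'b atom list \<Rightarrow> 'b list set" where
  "lang [] = {[]}"
| "lang (X # Ps) = {x @ y | x y. x \<in> atom_lang X \<and> y \<in> lang Ps}"

lemma lang_ConsI: "x \<in> atom_lang X \<Longrightarrow> y \<in> lang Ps \<Longrightarrow> x @ y \<in> lang (X # Ps)"
  by auto

lemma lang_append: "lang (Ps @ Rs) = {x @ y | x y. x \<in> lang Ps \<and> y \<in> lang Rs}"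
proof (induction Ps)
  case (Cons X Ps)
  show ?case
  proof (intro equalityI subsetI)
    fix z assume "z \<in> lang ((X # Ps) @ Rs)"
    then obtain x y u where "z = x @ y @ u" "x \<in> atom_lang X" "y \<in> lang Ps" "u \<in> lang Rs"
      using Cons.IH by auto
    moreover from this have "x @ y \<in> lang (X # Ps)" by auto
    ultimately show "z \<in> {x @ y | x y. x \<in> lang (X # Ps) \<and> y \<in> lang Rs}"
      by (metis (mono_tags, lifting) append_assoc mem_Collect_eq)
  next
    fix z assume "z \<in> {x @ y | x y. x \<in> lang (X # Ps) \<and> y \<in> lang Rs}"
    then obtain x y u where "z = x @ y @ u" "x \<in> atom_lang X" "y \<in> lang Ps" "u \<in> lang Rs"
      by auto
    moreover from this have "y @ u \<in> lang (Ps @ Rs)" using Cons.IH by auto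
    ultimately show "z \<in> lang ((X # Ps) @ Rs)" by auto
  qed
qed simp

lemma Nil_in_lang: "[] \<in> lang Ps"
proof (induction Ps)
  case (Cons X Ps)
  then show ?case by (cases X) auto
qed simp

lemma concat_in_lang: "list_all2 (\<lambda>x X. x \<in> atom_lang X) xs Ps \<Longrightarrow> concat xs \<in> lang Ps"
  by (induction rule: list_all2_induct) auto

lemma lang_decompose:
  "x \<in> lang Ps \<Longrightarrow> \<exists>xs. list_all2 (\<lambda>x X. x \<in> atom_lang X) xs Ps \<and> concat xs = x"
proof (induction Ps arbitrary: x)
  case (Cons X Ps)
  then obtain y z where "x = y @ z" "y \<in> atom_lang X" "z \<in> lang Ps" by auto
  moreover from this obtain xs where "list_all2 (\<lambda>x X. x \<in> atom_lang X) xs Ps" "concat xs = z"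
    using Cons.IH by blast
  ultimately show ?case by (intro exI[of _ "y # xs"]) auto
qed simp

lemma atom_lang_subseq: "subseq y x \<Longrightarrow> x \<in> atom_lang X \<Longrightarrow> y \<in> atom_lang X"
proof (cases X)
  case (Opt t)
  assume "subseq y x" "x \<in> atom_lang X"
  then show ?thesis by (cases y) (auto simp: Opt append_eq_Cons_conv dest!: list_emb_ConsD)
next
  case (Star A)
  assume "subseq y x" "x \<in> atom_lang X"
  then show ?thesis by (auto simp: Star dest: list_emb_set)
qed

lemma lang_subseq: "subseq y x \<Longrightarrow> x \<in> lang Ps \<Longrightarrow> y \<in> lang Ps"
proof (induction Ps arbitrary: x y)
  case (Cons X Ps)
  then obtain x1 x2 where x: "x = x1 @ x2" "x1 \<in> atom_lang X" "x2 \<in> lang Ps" by auto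
  then obtain y1 y2 where "y = y1 @ y2" "subseq y1 x1" "subseq y2 x2"
    using Cons.prems(1) by (auto elim: subseq_appendE)
  then show ?case using x Cons.IH atom_lang_subseq lang_ConsI by metis
qed simp

text \<open>Measure for the multiset order. The \<open>Suc\<close> puts every \<open>Star\<close>
  strictly above every \<open>Opt\<close>, so one \<open>Star A\<close> may be traded for any number
  of \<open>Opt\<close> atoms and of \<open>Star\<close> atoms over sets of smaller
  cardinality.\<close>

definition weights :: "'b atom list \<Rightarrow> nat multiset" where
  "weights Ps = mset (map (case_atom (\<lambda>_. 0) (\<lambda>A. Suc (card A))) Ps)"

definition finite_stars :: "'b atom list \<Rightarrow> bool" where
  "finite_stars Ps \<longleftrightarrow> (\<forall>A. Star A \<in> set Ps \<longrightarrow> finite A)"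

text \<open>For \<open>w \<noteq> []\<close> and \<open>w\<close> over \<open>A\<close>, \<open>avoid A w\<close> denotes the words over \<open>A\<close> without subsequence \<open>w\<close>,
  read off from the greedy leftmost embedding.\<close>

fun avoid :: "'b set \<Rightarrow> 'b list \<Rightarrow> 'b atom list" where
  "avoid A [] = []"
| "avoid A (a # w) = Star (A - {a}) # Opt a # avoid A w"

text \<open>Cut \<open>x\<close> at the first occurrence of \<open>a\<close>, if there is one: no
  \<open>a\<close> occurs before it, and the rest cannot contain \<open>w\<close>, since otherwise
  \<open>a # w\<close> would embed into \<open>x\<close>.\<close>

lemma in_avoid: "x \<in> lists A \<Longrightarrow> \<not> subseq w x \<Longrightarrow> x \<in> lang (avoid A w)"
proof (induction w arbitrary: x)
  case (Cons a w)
  show ?case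
  proof (cases "a \<in> set x")
    case False
    then have "x \<in> lists (A - {a})" using Cons.prems by auto
    then have "x @ [] \<in> lang (Star (A - {a}) # Opt a # avoid A w)"
      by (intro lang_ConsI Nil_in_lang) simp
    then show ?thesis by (simp only: avoid.simps append_Nil2)
  next
    case True
    then obtain y z where x: "x = y @ a # z" "a \<notin> set y" by (meson split_list_first)
    then have "y \<in> lists (A - {a})" "z \<in> lists A" using Cons.prems by auto
    moreover have "\<not> subseq w z"
      using Cons.prems(2) unfolding x(1) by (metis list_emb_append2 subseq_Cons2)
    ultimately have "z \<in> lang (avoid A w)" using Cons.IH by blast
    then have "[a] @ z \<in> lang (Opt a # avoid A w)" by (intro lang_ConsI) auto
    then have "y @ [a] @ z \<in> lang (Star (A - {a}) # Opt a # avoid A w)"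
      by (rule lang_ConsI[rotated]) (use \<open>y \<in> lists (A - {a})\<close> in simp)
    then show ?thesis by (simp only: avoid.simps x(1) append_Cons append_Nil)
  qed
qed simp

text \<open>Each removed letter belongs to \<open>A\<close>, so every set \<open>A - {a}\<close> is
  strictly smaller than \<open>A\<close>.\<close>

lemma avoid_weights:
  assumes "finite A" "set w \<subseteq> A" "k \<in># weights (avoid A w)"
  shows "k < Suc (card A)"
  using assms(2,3)
proof (induction w)
  case (Cons a w)
  then have "card (A - {a}) < card A" using assms(1) by (intro card_Diff1_less) auto
  moreover have "k = Suc (card (A - {a})) \<or> k = 0 \<or> k \<in># weights (avoid A w)"
    using Cons.prems(2) by (auto simp: weights_def)
  ultimately show ?case using Cons.IH Cons.prems(1) by auto
qed (simp add: weights_def)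

lemma avoid_finite_stars: "finite A \<Longrightarrow> finite_stars (avoid A w)"
  by (induction w) (auto simp: finite_stars_def)

section \<open>Full factors and covers of minimal weight\<close>

definition enum :: "'b set \<Rightarrow> 'b list" where
  "enum A = (SOME w. set w = A)"

lemma set_enum: "finite A \<Longrightarrow> set (enum A) = A"
  unfolding enum_def by (rule someI_ex) (rule finite_list)

text \<open>For finite \<open>A\<close>, a factor that is full for \<open>Star A\<close> has every
  word over \<open>A\<close> of length at most \<open>K\<close> as a subsequence. For this it
  suffices that \<open>enum A\<close> lists each letter at least once.\<close>

fun full :: "nat \<Rightarrow> 'b atom \<Rightarrow> 'b list \<Rightarrow> bool" where
  "full K (Opt t) x \<longleftrightarrow> x = [t]"
| "full K (Star A) x \<longleftrightarrow> subseq (concat (replicate K (enum A))) x"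

fun refine :: "nat \<Rightarrow> 'b atom \<Rightarrow> 'b atom list" where
  "refine K (Opt t) = []"
| "refine K (Star A) = avoid A (concat (replicate K (enum A)))"

lemma in_refine: "x \<in> atom_lang X \<Longrightarrow> \<not> full K X x \<Longrightarrow> x \<in> lang (refine K X)"
  by (cases X) (auto simp: in_avoid)

definition minimal_cover :: "'b list set \<Rightarrow> 'b atom list \<Rightarrow> bool" where
  "minimal_cover D Ps \<longleftrightarrow> finite_stars Ps \<and> D \<subseteq> lang Ps \<and>
    (\<forall>Rs. finite_stars Rs \<and> D \<subseteq> lang Rs \<longrightarrow> (weights Rs, weights Ps) \<notin> mult less_than)"

text \<open>The product \<open>[Star A]\<close> is a cover, and the multiset extension of
  \<open><\<close> is well founded.\<close>

lemma ex_minimal_cover: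
  assumes "finite A" "D \<subseteq> lists A"
  shows "\<exists>Ps. minimal_cover D Ps"
proof -
  have "wf (inv_image (mult less_than) weights)" by (simp add: wf_mult)
  moreover have "[Star A] \<in> {Ps. finite_stars Ps \<and> D \<subseteq> lang Ps}"
    using assms by (auto simp: finite_stars_def)
  ultimately obtain Ps where "Ps \<in> {Ps. finite_stars Ps \<and> D \<subseteq> lang Ps}"
    "\<And>Rs. (Rs, Ps) \<in> inv_image (mult less_than) weights \<Longrightarrow> Rs \<notin> {Ps. finite_stars Ps \<and> D \<subseteq> lang Ps}"
    by (rule wfE_min) blast
  then show ?thesis unfolding minimal_cover_def by auto
qed

definition directed :: "'b list set \<Rightarrow> bool" where
  "directed D \<longleftrightarrow> D \<noteq> {} \<and> (\<forall>x \<in> D. \<forall>y \<in> D. \<exists>z \<in> D. subseq x z \<and> subseq y z)"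

text \<open>Each condition persists above its witness, so an upper bound of the finitely many
  witnesses satisfies all conditions at once.\<close>

lemma directed_finite_bound:
  assumes "directed D" "finite J" "\<forall>j \<in> J. \<exists>y \<in> D. \<forall>x. subseq y x \<longrightarrow> R j x"
  shows "\<exists>y \<in> D. \<forall>j \<in> J. \<forall>x. subseq y x \<longrightarrow> R j x"
  using assms(2,3)
proof (induction J)
  case empty
  then show ?case using assms(1) by (auto simp: directed_def)
next
  case (insert j J)
  then obtain y z where "y \<in> D" "z \<in> D" "\<forall>x. subseq y x \<longrightarrow> R j x"
    "\<forall>j \<in> J. \<forall>x. subseq z x \<longrightarrow> R j x" by auto
  moreover from this obtain u where "u \<in> D" "subseq y u" "subseq z u"
    using assms(1) unfolding directed_def by blast
  ultimately show ?case by (intro bexI[of _ u]) (blast intro: subseq_order.trans)+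
qed

text \<open>Refining the \<open>i\<close>-th atom lowers the weight, so by minimality some
  \<open>y\<close> in \<open>D\<close> escapes the refined product. A word above \<open>y\<close>
  with a factor that is not full at \<open>i\<close> would lie in the refined product, and so would
  \<open>y\<close>.\<close>

lemma minimal_cover_full_at:
  assumes "minimal_cover D Ps" "i < length Ps" "D \<noteq> {}"
  shows "\<exists>y \<in> D. \<forall>x. subseq y x \<longrightarrow>
    (\<forall>xs. list_all2 (\<lambda>x X. x \<in> atom_lang X) xs Ps \<and> concat xs = x \<longrightarrow> full K (Ps ! i) (xs ! i))"
proof (cases "\<exists>A. Ps ! i = Star A \<and> concat (replicate K (enum A)) = []")
  case True
  \<comment> \<open>The repeated word is empty, so every factor is full and any member of
    \<open>D\<close> serves.\<close>
  then show ?thesis using assms(3) by auto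
next
  case False
  define Rs where "Rs = take i Ps @ refine K (Ps ! i) @ drop (Suc i) Ps"
  have Ps: "Ps = take i Ps @ (Ps ! i) # drop (Suc i) Ps"
    using assms(2) by (simp add: id_take_nth_drop)
  have fin: "finite A" if "Ps ! i = Star A" for A
    using assms(1,2) that nth_mem[of i Ps] by (auto simp: minimal_cover_def finite_stars_def)
  have sub: "set (concat (replicate K (enum A))) \<subseteq> A" if "Ps ! i = Star A" for A
    using set_enum[OF fin[OF that]] by auto
  let ?M = "weights (take i Ps) + weights (drop (Suc i) Ps)"
  \<comment> \<open>This is one step of the multiset order: a single weight is replaced by finitely
    many smaller ones, by none at all for \<open>Opt\<close>.\<close>
  have "\<forall>k \<in># weights (refine K (Ps ! i)). \<exists>j \<in># weights [Ps ! i]. (k, j) \<in> less_than"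
  proof (cases "Ps ! i")
    case (Star A)
    then show ?thesis using avoid_weights[OF fin[OF Star] sub[OF Star]]
      by (auto simp: weights_def)
  qed (auto simp: weights_def)
  then have "(?M + weights (refine K (Ps ! i)), ?M + weights [Ps ! i]) \<in> mult less_than"
    by (intro one_step_implies_mult) (auto simp: weights_def)
  moreover have "weights Rs = ?M + weights (refine K (Ps ! i))"
    by (simp add: Rs_def weights_def)
  moreover have "weights Ps = ?M + weights [Ps ! i]"
    by (subst Ps) (simp add: weights_def)
  ultimately have "(weights Rs, weights Ps) \<in> mult less_than" by simp
  moreover have "finite_stars Rs"
  proof -
    have "finite_stars (refine K (Ps ! i))"
      using fin avoid_finite_stars by (cases "Ps ! i") (auto simp: finite_stars_def)
    then show ?thesis using assms(1)
      by (auto simp: Rs_def minimal_cover_def finite_stars_def dest: in_set_takeD in_set_dropD)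
  qed
  ultimately obtain y where y: "y \<in> D" "y \<notin> lang Rs"
    using assms(1) by (auto simp: minimal_cover_def)
  have "full K (Ps ! i) (xs ! i)"
    if "subseq y (concat xs)" "list_all2 (\<lambda>x X. x \<in> atom_lang X) xs Ps" for xs
  proof (rule ccontr)
    assume n: "\<not> full K (Ps ! i) (xs ! i)"
    have i: "i < length xs" using that assms(2) list_all2_lengthD by force
    have "xs ! i \<in> lang (refine K (Ps ! i))"
      using n in_refine list_all2_nthD[OF that(2) i] by blast
    moreover have "concat (take i xs) \<in> lang (take i Ps)"
      "concat (drop (Suc i) xs) \<in> lang (drop (Suc i) Ps)"
      using that(2) by (auto intro!: concat_in_lang list_all2_takeI list_all2_dropI)
    moreover have "concat xs = concat (take i xs) @ xs ! i @ concat (drop (Suc i) xs)"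
      by (subst id_take_nth_drop[OF i]) simp
    ultimately have "concat xs \<in> lang Rs"
      unfolding Rs_def lang_append by blast
    then show False using y that(1) lang_subseq by blast
  qed
  then show ?thesis using y(1) by blast
qed

text \<open>Fullness is available at each position separately; directedness merges the finitely many
  witnesses into one member of \<open>D\<close> that is full everywhere.\<close>

lemma minimal_cover_full:
  assumes "minimal_cover D Ps" "directed D"
  shows "\<exists>xs. concat xs \<in> D \<and> list_all2 (\<lambda>x X. x \<in> atom_lang X \<and> full K X x) xs Ps"
proof -
  have "D \<noteq> {}" using assms(2) by (simp add: directed_def)
  then have "\<exists>y \<in> D. \<forall>i \<in> {..<length Ps}. \<forall>x. subseq y x \<longrightarrow>
    (\<forall>xs. list_all2 (\<lambda>x X. x \<in> atom_lang X) xs Ps \<and> concat xs = x \<longrightarrow> full K (Ps ! i) (xs ! i))"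
    using assms minimal_cover_full_at by (intro directed_finite_bound) auto
  then obtain y where y: "y \<in> D" "\<forall>i < length Ps. \<forall>xs. list_all2 (\<lambda>x X. x \<in> atom_lang X) xs Ps \<and>
    concat xs = y \<longrightarrow> full K (Ps ! i) (xs ! i)" by auto
  then have "y \<in> lang Ps" using assms(1) by (auto simp: minimal_cover_def)
  then obtain xs where "list_all2 (\<lambda>x X. x \<in> atom_lang X) xs Ps" "concat xs = y"
    using lang_decompose by blast
  then show ?thesis using y by (intro exI[of _ xs]) (auto simp: list_all2_conv_all_nth)
qed

section \<open>Ideals of paths\<close>

text \<open>Each letter of \<open>y\<close> is found in a copy of \<open>v\<close> of its
  own.\<close>

lemma subseq_concat_replicate:
  "set y \<subseteq> set v \<Longrightarrow> length y \<le> K \<Longrightarrow> subseq y (concat (replicate K v))"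
proof (induction y arbitrary: K)
  case (Cons a y)
  then obtain K' where K: "K = Suc K'" "length y \<le> K'" by (cases K) auto
  have "subseq [a] v" using Cons.prems by (simp add: subseq_singleton_left)
  then have "subseq ([a] @ y) (v @ concat (replicate K' v))"
    using Cons K by (intro list_emb_append_mono) auto
  then show ?case by (simp add: K)
qed simp

text \<open>Cut \<open>x\<close> into blocks that each receive one copy of \<open>w\<close>. The
  last block also takes the remainder of \<open>x\<close>, which is why \<open>0 < K\<close> is
  assumed.\<close>

lemma subseq_replicate_split:
  "subseq (concat (replicate K w)) x \<Longrightarrow> 0 < K \<Longrightarrow>
    \<exists>bs. length bs = K \<and> concat bs = x \<and> (\<forall>b \<in> set bs. subseq w b)"
proof (induction K arbitrary: x)
  case (Suc K)
  from Suc.prems(1) obtain y z where x: "x = y @ z" "subseq w y" "subseq (concat (replicate K w)) z"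
    by (auto dest: list_emb_appendD)
  show ?case
  proof (cases "K = 0")
    case True
    have "subseq w x" using x by auto
    then show ?thesis using True by (intro exI[of _ "[x]"]) auto
  next
    case False
    then obtain bs where "length bs = K" "concat bs = z" "\<forall>b \<in> set bs. subseq w b"
      using Suc.IH x by blast
    then show ?thesis using x by (intro exI[of _ "y # bs"]) auto
  qed
qed simp

text \<open>Pigeonhole on the states at the block boundaries: the path between two equal states is a
  loop containing a whole block, hence all letters of \<open>w\<close>.\<close>

lemma long_path_loop:
  assumes E: "E \<subseteq> Q \<times> \<Sigma> \<times> Q" and Q: "finite Q" "s \<in> Q"
    and x: "path E s x m" "subseq (concat (replicate (Suc (card Q)) w)) x"
  shows "\<exists>a v b r. x = a @ v @ b \<and> path E s a r \<and> path E r v r \<and> path E r b m \<and> set w \<subseteq> set v"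
proof -
  obtain bs where bs: "length bs = Suc (card Q)" "concat bs = x" "\<forall>b \<in> set bs. subseq w b"
    using subseq_replicate_split[OF x(2)] by blast
  have cut: "\<exists>r. path E s (concat (take i bs)) r \<and> path E r (concat (drop i bs)) m" for i
    using x(1) bs(2) path_append[of E s "concat (take i bs)" "concat (drop i bs)" m]
    by (simp flip: concat_append)
  then obtain f where f: "\<And>i. path E s (concat (take i bs)) (f i)"
    "\<And>i. path E (f i) (concat (drop i bs)) m" by metis
  have "f ` {..card Q} \<subseteq> Q" using f(1) path_end_in[OF _ E Q(2)] by blast
  then have "card (f ` {..card Q}) \<le> card Q" using Q(1) card_mono by blast
  \<comment> \<open>The cuts \<open>0\<close> to \<open>card Q\<close> outnumber the states by one.
    The cut behind the last block is left out, so a block begins at each of them.\<close>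
  then have "\<not> inj_on f {..card Q}" using card_image by fastforce
  then obtain i j where ij: "i < j" "j \<le> card Q" "f i = f j"
    by (metis inj_onI atMost_iff linorder_neqE_nat)
  define v where "v = concat (take (j - i) (drop i bs))"
  have "take j bs = take i bs @ take (j - i) (drop i bs)"
    using ij(1) by (metis le_add_diff_inverse less_imp_le take_add)
  then have tj: "concat (take j bs) = concat (take i bs) @ v" by (simp add: v_def)
  then have "path E (f i) v (f j)"
    using f(1)[of j] f(1)[of i] unfolding tj path_append by (metis path_functional)
  moreover have "x = concat (take i bs) @ v @ concat (drop j bs)"
    using tj bs(2) append_take_drop_id[of j bs] concat_append[of "take j bs" "drop j bs"] by simp
  moreover have "set w \<subseteq> set v"
  proof -
    have "drop i bs \<noteq> []" "j - i \<noteq> 0" using ij bs(1) by auto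
    then have "hd (drop i bs) \<in> set (take (j - i) (drop i bs))"
      by (cases "drop i bs"; cases "j - i") auto
    moreover from this have "subseq w (hd (drop i bs))" using bs(3)
      by (meson in_set_dropD in_set_takeD)
    ultimately show ?thesis unfolding v_def
      by (auto dest: list_emb_set)
  qed
  ultimately show ?thesis using f(1)[of i] f(2)[of j] ij(3)
    by (intro exI[of _ "concat (take i bs)"] exI[of _ v] exI[of _ "concat (drop j bs)"] exI[of _ "f i"]) auto
qed

text \<open>Turns one full factor into a pattern whose pumped words stay inside the atom and are
  cofinal in it.\<close>

lemma atom_loops:
  assumes E: "E \<subseteq> Q \<times> \<Sigma> \<times> Q" and Q: "finite Q" "s \<in> Q" and X: "finite_stars [X]"
    and x: "path E s x m" "x \<in> atom_lang X" "full (Suc (card Q)) X x"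
  shows "\<exists>r. loops E s r m \<and> (\<forall>ks. length ks = length r \<longrightarrow> pump r ks \<in> atom_lang X) \<and>
    (\<forall>y \<in> atom_lang X. \<exists>ks. length ks = length r \<and> subseq y (pump r ks))"
proof (cases X)
  case (Opt t)
  then show ?thesis using x
    \<comment> \<open>The loop is empty, so any exponent gives \<open>[t]\<close>, the largest word
      of the atom.\<close>
    by (intro exI[of _ "[([], [t])]"]) (auto simp: length_Suc_conv intro!: exI[of _ "[0]"])
next
  case (Star A)
  then have "finite A" using X by (simp add: finite_stars_def)
  from x Star have "subseq (concat (replicate (Suc (card Q)) (enum A))) x" by simp
  from long_path_loop[OF E Q x(1) this] obtain a v b q where *: "x = a @ v @ b" "path E s a q"
    "path E q v q" "path E q b m" "A \<subseteq> set v"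
    using set_enum[OF \<open>finite A\<close>] by auto
  have sub: "set a \<subseteq> A" "set v \<subseteq> A" "set b \<subseteq> A" using x(2) *(1) Star by auto
  \<comment> \<open>The empty loop only carries the prefix \<open>a\<close>; the real loop is
    \<open>v\<close>, in which all letters of \<open>A\<close> occur.\<close>
  let ?r = "[([], a), (v, b)]"
  have "loops E s ?r m" using * by auto
  moreover have "pump ?r ks \<in> atom_lang X" if ks: "length ks = length ?r" for ks
  proof -
    obtain k l where "ks = [k, l]" using ks by (auto simp: length_Suc_conv)
    then show ?thesis using sub Star by auto
  qed
  moreover have "\<exists>ks. length ks = length ?r \<and> subseq y (pump ?r ks)" if "y \<in> atom_lang X" for y
  proof -
    have "set y \<subseteq> set v" using that Star *(5) by auto
    then have "subseq y (concat (replicate (length y) v))" by (simp add: subseq_concat_replicate)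
    then have "subseq y (pump ?r [0, length y])" by (simp add: list_emb_append2 list_emb_prefix)
    then show ?thesis by (intro exI[of _ "[0, length y]"]) simp
  qed
  ultimately show ?thesis by blast
qed

lemma loops_append: "loops E s r m \<Longrightarrow> loops E m r' e \<Longrightarrow> loops E s (r @ r') e"
  by (induction r arbitrary: s) (auto, blast)

lemma pump_append:
  "length ks = length r \<Longrightarrow> pump (r @ r') (ks @ ls) = pump r ks @ pump r' ls"
  by (simp add: pump_def)

lemma product_loops:
  assumes E: "E \<subseteq> Q \<times> \<Sigma> \<times> Q" and Q: "finite Q"
    and xs: "list_all2 (\<lambda>x X. x \<in> atom_lang X \<and> full (Suc (card Q)) X x) xs Ps"
    and "path E s (concat xs) e" "s \<in> Q" "finite_stars Ps"
  shows "\<exists>r. loops E s r e \<and> (\<forall>ks. length ks = length r \<longrightarrow> pump r ks \<in> lang Ps) \<and>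
    (\<forall>y \<in> lang Ps. \<exists>ks. length ks = length r \<and> subseq y (pump r ks))"
  using xs assms(4-)
proof (induction xs Ps arbitrary: s rule: list_all2_induct)
  case Nil
  then show ?case by (intro exI[of _ "[]"]) auto
next
  case (Cons x xs X Ps)
  then obtain m where m: "path E s x m" "path E m (concat xs) e" by (auto simp: path_append)
  have X: "finite_stars [X]" and Ps: "finite_stars Ps"
    using Cons.prems by (auto simp: finite_stars_def)
  have mQ: "m \<in> Q" using path_end_in[OF m(1) E Cons.prems(2)] .
  obtain r where r: "loops E s r m" "\<And>ks. length ks = length r \<Longrightarrow> pump r ks \<in> atom_lang X"
    "\<And>y. y \<in> atom_lang X \<Longrightarrow> \<exists>ks. length ks = length r \<and> subseq y (pump r ks)"
    using atom_loops[OF E Q Cons.prems(2) X m(1)] Cons.hyps by blast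
  obtain r' where r': "loops E m r' e" "\<And>ks. length ks = length r' \<Longrightarrow> pump r' ks \<in> lang Ps"
    "\<And>y. y \<in> lang Ps \<Longrightarrow> \<exists>ks. length ks = length r' \<and> subseq y (pump r' ks)"
    using Cons.IH[OF m(2) mQ Ps] by blast
  have "pump (r @ r') ks \<in> lang (X # Ps)" if "length ks = length (r @ r')" for ks
  proof -
    have "pump (r @ r') (take (length r) ks @ drop (length r) ks) =
      pump r (take (length r) ks) @ pump r' (drop (length r) ks)"
      using that by (intro pump_append) simp
    then show ?thesis using that r(2)[of "take (length r) ks"] r'(2)[of "drop (length r) ks"] by force
  qed
  moreover have "\<exists>ks. length ks = length (r @ r') \<and> subseq y (pump (r @ r') ks)"
    if y: "y \<in> lang (X # Ps)" for y
  proof -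
    obtain y1 y2 where "y = y1 @ y2" "y1 \<in> atom_lang X" "y2 \<in> lang Ps" using y by auto
    moreover from this obtain ks ls where "length ks = length r" "subseq y1 (pump r ks)"
      "length ls = length r'" "subseq y2 (pump r' ls)" using r(3) r'(3) by meson
    ultimately show ?thesis
      by (intro exI[of _ "ks @ ls"]) (auto simp: pump_append intro!: list_emb_append_mono)
  qed
  ultimately show ?case using loops_append[OF r(1) r'(1)] by blast
qed

text \<open>Compares factor by factor: a full factor dominates every word of its atom that is not
  longer than \<open>K\<close>. Hence \<open>K\<close>-full words for growing \<open>K\<close>
  eventually dominate each word of the product.\<close>

lemma lang_subseq_full:
  assumes "list_all2 (\<lambda>x X. full K X x) xs Ps" "y \<in> lang Ps" "length y \<le> K" "finite_stars Ps"
  shows "subseq y (concat xs)"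
  using assms
proof (induction xs Ps arbitrary: y rule: list_all2_induct)
  case (Cons x xs X Ps)
  then obtain y1 y2 where y: "y = y1 @ y2" "y1 \<in> atom_lang X" "y2 \<in> lang Ps" by auto
  have "subseq y2 (concat xs)"
    using Cons y by (auto simp: finite_stars_def)
  moreover have "subseq y1 x"
  proof (cases X)
    case (Opt t)
    then show ?thesis using y Cons.hyps by auto
  next
    case (Star A)
    then have "set (enum A) = A" using Cons.prems(3) by (intro set_enum) (auto simp: finite_stars_def)
    then have "subseq y1 (concat (replicate K (enum A)))"
      using y Cons.prems(2) Star by (intro subseq_concat_replicate) auto
    then show ?thesis using Cons.hyps Star subseq_order.trans by auto
  qed
  ultimately show ?case by (simp add: y list_emb_append_mono)
qed auto

text \<open>Fullness of a minimal cover is used at two levels: once with a bound depending on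
  \<open>Q\<close> to find the loops, and once for each path with its own length to show that it
  lies in \<open>D\<close>.\<close>

lemma path_ideal_pattern:
  assumes E: "E \<subseteq> Q \<times> \<Sigma> \<times> Q" and Q: "finite Q" "finite \<Sigma>" "s \<in> Q"
    and D: "directed D" "\<And>x. x \<in> D \<Longrightarrow> path E s x e"
    and down: "\<And>x y. path E s x e \<Longrightarrow> y \<in> D \<Longrightarrow> subseq x y \<Longrightarrow> x \<in> D"
  shows "\<exists>r. loops E s r e \<and>
    D = {x. path E s x e \<and> (\<exists>ks. length ks = length r \<and> subseq x (pump r ks))}"
proof -
  have "finite E" using E Q by (auto intro: finite_subset)
  moreover have "D \<subseteq> lists E" using D(2) path_subset by (metis in_listsI subsetD subsetI)
  ultimately obtain Ps where Ps: "minimal_cover D Ps" using ex_minimal_cover by blast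
  then have fin: "finite_stars Ps" and DP: "D \<subseteq> lang Ps" by (auto simp: minimal_cover_def)
  obtain xs where "concat xs \<in> D"
    "list_all2 (\<lambda>x X. x \<in> atom_lang X \<and> full (Suc (card Q)) X x) xs Ps"
    using minimal_cover_full[OF Ps D(1)] by blast
  then obtain r where r: "loops E s r e" "\<And>ks. length ks = length r \<Longrightarrow> pump r ks \<in> lang Ps"
    "\<And>y. y \<in> lang Ps \<Longrightarrow> \<exists>ks. length ks = length r \<and> subseq y (pump r ks)"
    using product_loops[OF E Q(1) _ D(2) Q(3) fin] by blast
  have "x \<in> D" if x: "path E s x e" "subseq x (pump r ks)" "length ks = length r" for x ks
  proof -
    \<comment> \<open>Now the level is \<open>length x\<close>, so this member of \<open>D\<close>
      lies above \<open>x\<close>.\<close>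
    obtain zs where zs: "concat zs \<in> D"
      "list_all2 (\<lambda>z X. z \<in> atom_lang X \<and> full (length x) X z) zs Ps"
      using minimal_cover_full[OF Ps D(1)] by blast
    have "list_all2 (\<lambda>z X. full (length x) X z) zs Ps"
      using zs(2) by (rule list_all2_mono) simp
    then have "subseq x (concat zs)"
      using lang_subseq_full lang_subseq[OF x(2) r(2)[OF x(3)]] fin by blast
    then show ?thesis using down x(1) zs(1) by blast
  qed
  then have "D = {x. path E s x e \<and> (\<exists>ks. length ks = length r \<and> subseq x (pump r ks))}"
    using DP r(3) D(2) by blast
  then show ?thesis using r(1) by blast
qed

section \<open>The order as subsequence order on runs\<close>

text \<open>Recursive form of the index condition in \<open>loop_pattern\<close>; \<open>R\<close>
  is the state sequence and \<open>n\<close> the current position in it.\<close>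

fun loops_at :: "'q list \<Rightarrow> nat \<Rightarrow> ('a list \<times> 'a list) list \<Rightarrow> bool" where
  "loops_at R n [] \<longleftrightarrow> True"
| "loops_at R n ((v, u) # r) \<longleftrightarrow>
    R ! n = R ! (n + length v) \<and> loops_at R (n + length v + length u) r"

lemma loops_at_iff:
  "loops_at R (length u0) r \<longleftrightarrow>
    (\<forall>i < length r. R ! pat_start (u0, r) i = R ! (pat_start (u0, r) i + length (fst (r ! i))))"
proof (induction r arbitrary: u0)
  case (Cons a r)
  obtain v u where a: "a = (v, u)" by (cases a)
  have "pat_start (u0, a # r) (Suc i) = pat_start (u0 @ v @ u, r) i" for i
    by (simp add: pat_start_def a)
  moreover have "pat_start (u0, a # r) 0 = length u0" by (simp add: pat_start_def)
  ultimately show ?case using Cons.IH[of "u0 @ v @ u"]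
    by (auto simp: a All_less_Suc2 add.assoc)
qed simp

text \<open>Equal states at the marked positions say that the segments of the path between them are
  loops. The lift \<open>vu\<close> is obtained by cutting \<open>ys\<close> at the lengths given by
  \<open>r\<close>.\<close>

lemma loops_at_path_iff:
  assumes "path E s xs m" "path E m ys e" "label ys = word r"
  shows "loops_at (s # map tgt (xs @ ys)) (length xs) r \<longleftrightarrow>
    (\<exists>vu. loops E m vu e \<and> label_pat vu = r \<and> word vu = ys)"
  using assms
proof (induction r arbitrary: xs m ys)
  case Nil
  then show ?case by auto
next
  case (Cons a r)
  obtain v u where a: "a = (v, u)" by (cases a)
  from Cons.prems(3) obtain V U Y where ys: "ys = V @ U @ Y" "label V = v" "label U = u" "label Y = word r"
    by (auto simp: a map_eq_append_conv append_eq_map_conv)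
  then obtain m1 m2 where p: "path E m V m1" "path E m1 U m2" "path E m2 Y e"
    using Cons.prems(2) by (auto simp: path_append)
  have xs2: "path E s (xs @ V @ U) m2" using Cons.prems(1) p by (auto simp: path_append)
  have IH: "loops_at (s # map tgt (xs @ ys)) (length xs + length v + length u) r \<longleftrightarrow>
     (\<exists>vu. loops E m2 vu e \<and> label_pat vu = r \<and> word vu = Y)"
    using Cons.IH[OF xs2 p(3) ys(4)] ys by (auto simp: add.assoc)
  have xV: "path E s (xs @ V) m1" using Cons.prems(1) p by (auto simp: path_append)
  have e1: "(s # map tgt (xs @ ys)) ! length xs = m"
    using path_nth_length[OF Cons.prems(1)] .
  have e2: "(s # map tgt (xs @ ys)) ! (length xs + length v) = m1"
    using path_nth_length[OF xV, of "U @ Y"] ys by auto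
  have "loops_at (s # map tgt (xs @ ys)) (length xs) (a # r) \<longleftrightarrow>
     m = m1 \<and> (\<exists>vu. loops E m2 vu e \<and> label_pat vu = r \<and> word vu = Y)"
    using IH e1 e2 by (simp add: a)
  also have "\<dots> \<longleftrightarrow> (\<exists>vu. loops E m vu e \<and> label_pat vu = a # r \<and> word vu = ys)"
  proof
    assume "m = m1 \<and> (\<exists>vu. loops E m2 vu e \<and> label_pat vu = r \<and> word vu = Y)"
    then obtain vu where "m = m1" "loops E m2 vu e" "label_pat vu = r" "word vu = Y" by blast
    then show "\<exists>vu. loops E m vu e \<and> label_pat vu = a # r \<and> word vu = ys"
      using p ys by (intro exI[of _ "(V, U) # vu"]) (auto simp: a)
  next
    assume "\<exists>vu. loops E m vu e \<and> label_pat vu = a # r \<and> word vu = ys"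
    then obtain V' U' vu where *: "label V' = v" "label U' = u" "label_pat vu = r"
      "V' @ U' @ word vu = ys" "loops E m ((V', U') # vu) e"
      by (auto simp: a map_eq_Cons_conv)
    \<comment> \<open>Labelling preserves length, so both factorizations of \<open>ys\<close> have
      the same cuts.\<close>
    have "length V' = length V" "length U' = length U"
      using * ys by (metis length_map)+
    then have "V' = V" "U' = U" "word vu = Y" using * ys by auto
    then show "m = m1 \<and> (\<exists>vu. loops E m2 vu e \<and> label_pat vu = r \<and> word vu = Y)"
      using * p path_functional by (metis loops.simps(2))
  qed
  finally show ?case .
qed

section \<open>Accepting paths of a labeling automaton\<close>

locale labeling =
  fixes Q :: "'q set" and \<Sigma> :: "'a set" and E :: "('q, 'a) trans set" and I F :: "'q set"
  assumes labeling: "labeling_automaton Q \<Sigma> E I F"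
begin

lemma E_sub: "E \<subseteq> Q \<times> \<Sigma> \<times> Q" and finite_Q: "finite Q" and I_sub: "I \<subseteq> Q"
  using labeling by (auto simp: labeling_automaton_def finite_automaton_def)

definition acc :: "'q \<Rightarrow> ('q, 'a) trans list \<Rightarrow> 'q \<Rightarrow> bool" where
  "acc s ts e \<longleftrightarrow> s \<in> I \<and> e \<in> F \<and> path E s ts e"

lemma acc_label: "acc s ts e \<Longrightarrow> label ts \<in> lists \<Sigma>"
  using path_subset[of E s ts e] E_sub by (fastforce simp: acc_def)

lemma ex_acc: "w \<in> lists \<Sigma> \<Longrightarrow> \<exists>s ts e. acc s ts e \<and> label ts = w"
  using labeling unfolding labeling_automaton_def is_run_iff_path acc_def by blast

lemma the_run_acc:
  assumes "acc s ts e"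
  shows "the_run E I F (label ts) = s # map tgt ts"
proof -
  have "\<exists>!qs. is_run E I F (label ts) qs"
    using labeling acc_label[OF assms] by (auto simp: labeling_automaton_def)
  moreover have "is_run E I F (label ts) (s # map tgt ts)"
    using assms by (auto simp: is_run_iff_path acc_def)
  ultimately show ?thesis unfolding the_run_def by (rule the1_equality)
qed

text \<open>The unique run fixes the states and the label fixes the letters, together every
  transition. Words and accepting paths thus become interchangeable.\<close>

lemma acc_unique:
  assumes "acc s ts e" "acc s' ts' e'" "label ts = label ts'"
  shows "s = s' \<and> ts = ts' \<and> e = e'"
proof -
  have "s # map tgt ts = s' # map tgt ts'"
    using the_run_acc[OF assms(1)] the_run_acc[OF assms(2)] assms(3) by simp
  then show ?thesis
    using assms path_determined path_functional by (metis acc_def list.inject)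
qed

lemma loop_pattern_iff:
  "loop_pattern \<Sigma> E I F p \<longleftrightarrow>
    (\<exists>s u0 m vu e. acc s (u0 @ word vu) e \<and> path E s u0 m \<and> loops E m vu e
      \<and> p = (label u0, label_pat vu))"
proof -
  obtain l r where p: "p = (l, r)" by (cases p)
  have pw: "pat_word p = l @ word r" by (simp add: pat_word_def word_def p)
  show ?thesis
  proof
    assume lp: "loop_pattern \<Sigma> E I F p"
    then have "l @ word r \<in> lists \<Sigma>" using pw by (simp add: loop_pattern_def)
    then obtain s ts e where ts: "acc s ts e" "label ts = l @ word r"
      using ex_acc by blast
    then obtain u0 ys where u: "ts = u0 @ ys" "label u0 = l" "label ys = word r"
      by (auto simp: map_eq_append_conv)
    then obtain m where m: "path E s u0 m" "path E m ys e"
      using ts by (auto simp: acc_def path_append)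
    have "loops_at (s # map tgt (u0 @ ys)) (length l) r"
      unfolding loops_at_iff using lp the_run_acc[OF ts(1)] ts u pw by (auto simp: loop_pattern_def p)
    then have "loops_at (s # map tgt (u0 @ ys)) (length u0) r" using u by auto
    then obtain vu where "loops E m vu e" "label_pat vu = r" "word vu = ys"
      using loops_at_path_iff[OF m u(3)] by blast
    then show "\<exists>s u0 m vu e. acc s (u0 @ word vu) e \<and> path E s u0 m \<and> loops E m vu e
      \<and> p = (label u0, label_pat vu)"
      using ts u m p by blast
  next
    assume "\<exists>s u0 m vu e. acc s (u0 @ word vu) e \<and> path E s u0 m \<and> loops E m vu e
      \<and> p = (label u0, label_pat vu)"
    then obtain s u0 m vu e where *: "acc s (u0 @ word vu) e" "path E s u0 m" "loops E m vu e"
      "l = label u0" "r = label_pat vu" using p by blast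
    have lw: "label (u0 @ word vu) = l @ word r" using * by (simp add: word_label_pat)
    have "loops_at (s # map tgt (u0 @ word vu)) (length u0) r"
      using loops_at_path_iff[OF *(2) loops_word[OF *(3)], of r] * by (auto simp: word_label_pat)
    then have "loops_at (s # map tgt (u0 @ word vu)) (length l) r" using * by simp
    then show "loop_pattern \<Sigma> E I F p"
      unfolding loops_at_iff loop_pattern_def pw using the_run_acc[OF *(1), unfolded lw] acc_label[OF *(1), unfolded lw]
      by (auto simp: p)
  qed
qed

text \<open>A gap between two consecutive transitions of a path that is a subsequence of another path
  is automatically a loop, so only the end points have to be compared separately.\<close>

lemma leqA_iff:
  "leqA \<Sigma> E I F u v \<longleftrightarrow>
    (\<exists>s e us vs. acc s us e \<and> acc s vs e \<and> label us = u \<and> label vs = v \<and> subseq us vs)"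
proof
  assume "leqA \<Sigma> E I F u v"
  then obtain p where p: "loop_pattern \<Sigma> E I F p" "pat_word p = v" "pat_base p = u"
    by (auto simp: leqA_def)
  then obtain s u0 m vu e where *: "acc s (u0 @ word vu) e" "path E s u0 m" "loops E m vu e"
    "p = (label u0, label_pat vu)" by (auto simp: loop_pattern_iff)
  have "label (u0 @ word vu) = v" "label (u0 @ base vu) = u"
    using p * base_label_pat[of vu] word_label_pat[of vu]
    by (auto simp: pat_word_def pat_base_def base_def word_def)
  moreover have "acc s (u0 @ base vu) e"
    using * loops_base[OF *(3)] by (auto simp: acc_def path_append)
  moreover have "subseq (u0 @ base vu) (u0 @ word vu)" using list_emb_append_mono[OF subseq_order.refl subseq_base_word] .
  ultimately show "\<exists>s e us vs. acc s us e \<and> acc s vs e \<and> label us = u \<and> label vs = v \<and> subseq us vs"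
    using *(1) by blast
next
  assume "\<exists>s e us vs. acc s us e \<and> acc s vs e \<and> label us = u \<and> label vs = v \<and> subseq us vs"
  then obtain s e us vs where *: "acc s us e" "acc s vs e" "label us = u" "label vs = v" "subseq us vs"
    by blast
  then obtain vu where vu: "loops E s vu e" "word vu = vs" "base vu = us"
    using subseq_imp_loops[of E s us e vs] by (auto simp: acc_def)
  \<comment> \<open>The list \<open>vu\<close> already begins with a possibly empty loop at
    \<open>s\<close>, so the leading segment is empty.\<close>
  then have "loop_pattern \<Sigma> E I F ([], label_pat vu)"
    unfolding loop_pattern_iff using *
    by (intro exI[of _ s] exI[of _ "[]"] exI[of _ vu] exI[of _ e]) auto
  moreover have "pat_word ([], label_pat vu) = v" "pat_base ([], label_pat vu) = u"
    using vu * base_label_pat[of vu] word_label_pat[of vu]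
    by (auto simp: pat_word_def pat_base_def base_def word_def)
  ultimately show "leqA \<Sigma> E I F u v"
    using acc_label[OF *(1)] acc_label[OF *(2)] *(3,4) unfolding leqA_def by metis
qed

lemma leqA_labelI:
  "acc s us e \<Longrightarrow> acc s vs e \<Longrightarrow> subseq us vs \<Longrightarrow> leqA \<Sigma> E I F (label us) (label vs)"
  unfolding leqA_iff by (intro exI conjI; (assumption | rule refl))

lemma leqA_labelD:
  assumes "acc s us e" "acc s' vs e'" "leqA \<Sigma> E I F (label us) (label vs)"
  shows "s = s' \<and> e = e' \<and> subseq us vs"
proof -
  obtain t f xs ys where *: "acc t xs f" "acc t ys f" "label xs = label us" "label ys = label vs"
    "subseq xs ys" using assms(3) unfolding leqA_iff by blast
  show ?thesis
    using acc_unique[OF *(1) assms(1) *(3)] acc_unique[OF *(2) assms(2) *(4)] *(5) by simp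
qed

text \<open>The two accepting paths labelled \<open>v\<close> coincide, so transitivity of
  \<open>subseq\<close> applies.\<close>

lemma leqA_trans: "leqA \<Sigma> E I F u v \<Longrightarrow> leqA \<Sigma> E I F v w \<Longrightarrow> leqA \<Sigma> E I F u w"
  unfolding leqA_iff using acc_unique subseq_order.trans by metis

section \<open>From loop patterns to ideals and back\<close>

lemma pat_lang_label:
  "pat_lang (label u0, label_pat vu) = {label (u0 @ pump vu ks) | ks. length ks = length vu}"
proof -
  have "pat_lang (label u0, label_pat vu) =
    {label u0 @ pump (label_pat vu) ks | ks. length ks = length vu}"
    unfolding pat_lang_def pump_def by simp
  also have "\<dots> = {label (u0 @ pump vu ks) | ks. length ks = length vu}"
    by (rule Collect_cong) (metis map_append pump_label_pat)
  finally show ?thesis .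
qed

text \<open>Pumping keeps the end points and is monotone in the exponents, so pointwise maxima of
  exponents yield common upper bounds.\<close>

lemma ideal_of_pattern:
  assumes "loop_pattern \<Sigma> E I F p"
  shows "is_ideal \<Sigma> E I F (down_closure \<Sigma> E I F (pat_lang p))"
proof -
  obtain s u0 m vu e where *: "acc s (u0 @ word vu) e" "path E s u0 m" "loops E m vu e"
    "p = (label u0, label_pat vu)" using assms by (auto simp: loop_pattern_iff)
  let ?P = "\<lambda>ks. u0 @ pump vu ks"
  let ?D = "down_closure \<Sigma> E I F (pat_lang p)"
  have acc: "acc s (?P ks) e" if "length ks = length vu" for ks
    using * loops_pump[OF *(3) that] by (auto simp: acc_def path_append)
  have D: "x \<in> ?D \<longleftrightarrow> (\<exists>ks. length ks = length vu \<and> leqA \<Sigma> E I F x (label (?P ks)))" for x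
    unfolding down_closure_def *(4) pat_lang_label by blast
  have mono: "leqA \<Sigma> E I F (label (?P ks)) (label (?P ls))"
    if "length ks = length vu" "list_all2 (\<le>) ks ls" for ks ls
  proof -
    have "length ls = length vu" using that list_all2_lengthD by force
    then show ?thesis
      using acc that subseq_pump_mono[OF that(2), of vu] by (intro leqA_labelI list_emb_append_mono) auto
  qed
  have refl: "label (?P ks) \<in> ?D" if "length ks = length vu" for ks
    unfolding D using mono[OF that, of ks] that by (auto simp: list_all2_refl)
  have "\<exists>z \<in> ?D. leqA \<Sigma> E I F x z \<and> leqA \<Sigma> E I F y z" if "x \<in> ?D" "y \<in> ?D" for x y
  proof -
    obtain ks ls where kl: "length ks = length vu" "leqA \<Sigma> E I F x (label (?P ks))"
      "length ls = length vu" "leqA \<Sigma> E I F y (label (?P ls))" using \<open>x \<in> ?D\<close> \<open>y \<in> ?D\<close> D by blast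
    let ?ms = "map2 max ks ls"
    have "list_all2 (\<le>) ks ?ms" "list_all2 (\<le>) ls ?ms" "length ?ms = length vu"
      using kl by (auto simp: list_all2_conv_all_nth)
    then show ?thesis using kl mono refl leqA_trans by blast
  qed
  moreover have "?D \<noteq> {}" using refl[of "replicate (length vu) 0"] by auto
  moreover have "?D \<subseteq> lists \<Sigma>" by (auto simp: down_closure_def leqA_def)
  moreover have "x \<in> ?D" if "y \<in> ?D" "leqA \<Sigma> E I F x y" for x y
    using that leqA_trans unfolding D by blast
  ultimately show ?thesis unfolding is_ideal_def by blast
qed

text \<open>Comparable words have accepting paths with equal end points, so directedness imposes one
  pair of end points on all of \<open>D\<close>. The accepting paths over \<open>D\<close> then form
  the set \<open>T\<close>, to which \<open>path_ideal_pattern\<close> applies.\<close>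

lemma pattern_of_ideal:
  assumes "is_ideal \<Sigma> E I F D"
  shows "\<exists>p. loop_pattern \<Sigma> E I F p \<and> D = down_closure \<Sigma> E I F (pat_lang p)"
proof -
  have D: "D \<subseteq> lists \<Sigma>" "D \<noteq> {}" "\<And>x y. y \<in> D \<Longrightarrow> leqA \<Sigma> E I F x y \<Longrightarrow> x \<in> D"
    "\<And>x y. x \<in> D \<Longrightarrow> y \<in> D \<Longrightarrow> \<exists>z \<in> D. leqA \<Sigma> E I F x z \<and> leqA \<Sigma> E I F y z"
    using assms unfolding is_ideal_def leqA_def by blast+
  then obtain w where w: "w \<in> D" by blast
  then obtain s ts e where ts: "acc s ts e" "label ts = w" using D(1) ex_acc by blast
  define T where "T = {x. acc s x e \<and> label x \<in> D}"
  have same_ends: "\<exists>x \<in> T. label x = y" if "y \<in> D" for y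
  proof -
    \<comment> \<open>A common upper bound of \<open>w\<close> and \<open>y\<close> passes the end
      points of \<open>ts\<close> on to the path of \<open>y\<close>.\<close>
    obtain z where "leqA \<Sigma> E I F w z" "leqA \<Sigma> E I F y z" using D(4)[OF w \<open>y \<in> D\<close>] by blast
    moreover from this have "y \<in> lists \<Sigma>" "z \<in> lists \<Sigma>" by (auto simp: leqA_def)
    then obtain s1 a e1 s2 b e2 where ab: "acc s1 a e1" "label a = y" "acc s2 b e2" "label b = z"
      using ex_acc[of y] ex_acc[of z] by auto
    ultimately have "s = s2 \<and> e = e2" "s1 = s2 \<and> e1 = e2"
      using leqA_labelD[OF ts(1) ab(3)] leqA_labelD[OF ab(1) ab(3)] ts(2) by auto
    then have "a \<in> T" using ab(1,2) \<open>y \<in> D\<close> by (simp add: T_def)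
    then show ?thesis using ab(2) by blast
  qed
  have "directed T"
    unfolding directed_def
  proof (intro conjI ballI)
    show "T \<noteq> {}" using w ts by (auto simp: T_def)
    fix x y assume xy: "x \<in> T" "y \<in> T"
    then obtain z where z: "z \<in> D" "leqA \<Sigma> E I F (label x) z" "leqA \<Sigma> E I F (label y) z"
      using D(4) by (auto simp: T_def)
    obtain t where t: "t \<in> T" "label t = z" using same_ends z(1) by blast
    have "subseq x t" "subseq y t"
      using leqA_labelD[of s x e s t e] leqA_labelD[of s y e s t e] z(2,3) xy t
      by (auto simp: T_def)
    then show "\<exists>z \<in> T. subseq x z \<and> subseq y z" using t by blast
  qed
  moreover have sI: "s \<in> I" "e \<in> F" using ts by (auto simp: acc_def)
  moreover have "x \<in> T" if "path E s x e" "y \<in> T" "subseq x y" for x y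
  proof -
    have "acc s x e" "acc s y e" using that sI by (auto simp: acc_def T_def)
    then have "leqA \<Sigma> E I F (label x) (label y)" using that(3) by (rule leqA_labelI)
    then show ?thesis using D(3) that \<open>acc s x e\<close> by (auto simp: T_def)
  qed
  moreover have "finite \<Sigma>"
    using labeling by (simp add: labeling_automaton_def finite_automaton_def)
  moreover have "path E s x e" if "x \<in> T" for x using that by (simp add: T_def acc_def)
  ultimately obtain r where r: "loops E s r e"
    "T = {x. path E s x e \<and> (\<exists>ks. length ks = length r \<and> subseq x (pump r ks))}"
    using path_ideal_pattern[OF E_sub finite_Q, of s T e] I_sub by blast
  let ?p = "(label ([] :: ('q, 'a) trans list), label_pat r)"
  have "loop_pattern \<Sigma> E I F ?p"
    unfolding loop_pattern_iff using r(1) loops_word[OF r(1)] sI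
    by (intro exI[of _ s] exI[of _ "[]"] exI[of _ s] exI[of _ r] exI[of _ e]) (auto simp: acc_def)
  moreover have "D = down_closure \<Sigma> E I F (pat_lang ?p)"
  proof (intro equalityI subsetI)
    fix y assume "y \<in> D"
    then obtain x where x: "x \<in> T" "label x = y" using same_ends by blast
    then obtain ks where ks: "length ks = length r" "subseq x (pump r ks)" using r(2) by blast
    have "acc s (pump r ks) e" using loops_pump[OF r(1) ks(1)] sI by (simp add: acc_def)
    \<comment> \<open>The empty prefix is written out to match \<open>pat_lang_label\<close> with
      \<open>u0 = []\<close>.\<close>
    then have "leqA \<Sigma> E I F y (label ([] @ pump r ks))"
      using leqA_labelI[of s x e "pump r ks"] x ks by (auto simp: T_def)
    then show "y \<in> down_closure \<Sigma> E I F (pat_lang ?p)"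
      unfolding down_closure_def pat_lang_label using ks(1) by blast
  next
    fix y assume "y \<in> down_closure \<Sigma> E I F (pat_lang ?p)"
    then obtain ks where ks: "length ks = length r" "leqA \<Sigma> E I F y (label (pump r ks))"
      unfolding down_closure_def pat_lang_label by auto
    have "pump r ks \<in> T" using loops_pump[OF r(1) ks(1)] ks(1) r(2) by blast
    then show "y \<in> D" using D(3) ks(2) by (auto simp: T_def)
  qed
  ultimately show ?thesis by blast
qed

end

theorem mainTheorem12:
  fixes Q :: "'q set" and \<Sigma> :: "'a set" and E :: "('q \<times> 'a \<times> 'q) set" and I F :: "'q set"
  assumes "labeling_automaton Q \<Sigma> E I F"
  shows "is_ideal \<Sigma> E I F D \<longleftrightarrow>
    (\<exists>p. loop_pattern \<Sigma> E I F p \<and> D = down_closure \<Sigma> E I F (pat_lang p))"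
proof -
  interpret labeling Q \<Sigma> E I F by unfold_locales (rule assms)
  show ?thesis using ideal_of_pattern pattern_of_ideal by blast
qed

end
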